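(* Let $X$ be a complex Banach space, $J\subset X$ an $M$-ideal, and $x\in X$ a unit vector. Suppose $$\partial_x=\overline{CO}\{f\in\partial_e J^*_1: f(x)=1\},$$ with closure in the weak$^*$-topology of $X^*$. Suppose that at least one of the following holds: (1) $0\notin\overline{\partial_e J^*_1}$, where the closure is in the weak$^*$-topology of $J^*$; (2) $\overline{\partial_e J^*_1}\subset[0,1]\,\partial_e J^*_1$, where the closure is taken in the weak$^*$-topology of $X^*$. Then $d(x,J)<1$.
   Context: For a vector $x$ in a Banach space $X$, $\partial_x=\{f\in X^*:\|f\|=1,\ f(x)=\|x\|\}$. $E_1$ is the closed unit ball of a Banach space $E$, $\partial_e C$ is the set of extreme points of a convex set $C$, $CO$ denotes convex hull, the bar denotes closure, and $d(\cdot,\cdot)$ is norm distance. $[0,1]S=\{\lambda s:\lambda\in[0,1],\ s\in S\}$. A closed subspace $J\subset X$ is an $M$-ideal if there is a linear projection $P:X^*\to X^*$ with $\ker P=J^\perp$ (annihilator) and $\|x^*\|=\|P(x^* )\|+\|x^*-P(x^* )\|$ for all $x^*\in X^*$. In this case functionals in $J^*$ have unique norm-preserving extensions to $X$ and $J^*$ is identified with the range of $P$, so $X^*=J^*\oplus_1 J^\perp$; elements of $J^*$ are thus regarded as functionals on $X$. *)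

theory Defs
  imports "HOL-Analysis.Analysis"
begin

section \<open>Complex Banach spaces\<close>

class complex_normed_vector = real_normed_vector +
  fixes scaleC :: "complex \<Rightarrow> 'a \<Rightarrow> 'a"  (infixr \<open>*\<^sub>C\<close> 75)
  assumes scaleC_add_right: "a *\<^sub>C (x + y) = a *\<^sub>C x + a *\<^sub>C y"
    and scaleC_add_left: "(a + b) *\<^sub>C x = a *\<^sub>C x + b *\<^sub>C x"
    and scaleC_scaleC: "a *\<^sub>C (b *\<^sub>C x) = (a * b) *\<^sub>C x"
    and scaleC_of_real: "complex_of_real r *\<^sub>C x = r *\<^sub>R x"
    and norm_scaleC: "norm (a *\<^sub>C x) = cmod a * norm x"

class complex_banach = complex_normed_vector + complete_space

subclass (in complex_banach) banach ..

instantiation complex :: complex_banach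
begin

definition scaleC_complex :: "complex \<Rightarrow> complex \<Rightarrow> complex" where
  "scaleC_complex a z = a * z"

instance
  by standard (simp_all add: scaleC_complex_def algebra_simps norm_mult scaleR_conv_of_real)

end

definition csubspace :: "'a::complex_normed_vector set \<Rightarrow> bool" where
  "csubspace J \<longleftrightarrow>
     0 \<in> J \<and> (\<forall>x\<in>J. \<forall>y\<in>J. x + y \<in> J) \<and> (\<forall>c. \<forall>x\<in>J. c *\<^sub>C x \<in> J)"


section \<open>The dual space\<close>

text \<open>
  The type of bounded linear maps into \<^typ>\<open>complex\<close> consists of the real-linear ones. The dual of
  a complex space is its subset of complex-linear maps; the norm is the operator norm.
\<close>

definition cdual :: "('a::complex_normed_vector \<Rightarrow>\<^sub>L complex) set" where
  "cdual = {f. \<forall>c x. blinfun_apply f (c *\<^sub>C x) = c * blinfun_apply f x}"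

definition scale_functional ::
    "complex \<Rightarrow> ('a::complex_normed_vector \<Rightarrow>\<^sub>L complex) \<Rightarrow> ('a \<Rightarrow>\<^sub>L complex)" where
  "scale_functional c f = blinfun_mult_right c o\<^sub>L f"

lemma scale_functional_apply [simp]:
  "blinfun_apply (scale_functional c f) x = c * blinfun_apply f x"
  by (simp add: scale_functional_def)

definition annihilator :: "'a::complex_normed_vector set \<Rightarrow> ('a \<Rightarrow>\<^sub>L complex) set" where
  "annihilator J = {f \<in> cdual. \<forall>x\<in>J. blinfun_apply f x = 0}"

definition state_set :: "'a::complex_normed_vector \<Rightarrow> ('a \<Rightarrow>\<^sub>L complex) set" where
  "state_set x = {f \<in> cdual. norm f = 1 \<and> blinfun_apply f x = complex_of_real (norm x)}"

text \<open>
  The topology on a set \<open>F\<close> of functionals of pointwise convergence at the points of \<open>J\<close>.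
  For \<open>F = cdual\<close> and \<open>J = UNIV\<close> it is the weak-star topology of the dual of the whole space.
  If \<open>F\<close> is a copy of the dual of a subspace \<open>J\<close>, it is the weak-star topology of that dual.
\<close>

definition weak_star_topology ::
    "('a::complex_normed_vector \<Rightarrow>\<^sub>L complex) set \<Rightarrow> 'a set \<Rightarrow> ('a \<Rightarrow>\<^sub>L complex) topology" where
  "weak_star_topology F J =
     pullback_topology F (\<lambda>f. restrict (blinfun_apply f) J) (product_topology (\<lambda>_. euclidean) J)"

lemma topspace_weak_star_topology [simp]: "topspace (weak_star_topology F J) = F"
  by (auto simp: weak_star_topology_def topspace_pullback_topology)


section \<open>M-ideals\<close>

text \<open>
  Projections are represented by functions on the whole type of real-linear functionals;
  only their values on \<^const>\<open>cdual\<close> matter.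
\<close>

definition L_projection ::
    "(('a::complex_normed_vector \<Rightarrow>\<^sub>L complex) \<Rightarrow> ('a \<Rightarrow>\<^sub>L complex)) \<Rightarrow> bool" where
  "L_projection P \<longleftrightarrow>
     (\<forall>f\<in>cdual. P f \<in> cdual) \<and>
     (\<forall>f\<in>cdual. \<forall>g\<in>cdual. P (f + g) = P f + P g) \<and>
     (\<forall>c. \<forall>f\<in>cdual. P (scale_functional c f) = scale_functional c (P f)) \<and>
     (\<forall>f\<in>cdual. P (P f) = P f) \<and>
     (\<forall>f\<in>cdual. norm f = norm (P f) + norm (f - P f))"

definition M_ideal_projection ::
    "'a::complex_normed_vector set \<Rightarrow> (('a \<Rightarrow>\<^sub>L complex) \<Rightarrow> ('a \<Rightarrow>\<^sub>L complex)) \<Rightarrow> bool" where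
  "M_ideal_projection J P \<longleftrightarrow> L_projection P \<and> {f \<in> cdual. P f = 0} = annihilator J"

definition M_ideal :: "'a::complex_normed_vector set \<Rightarrow> bool" where
  "M_ideal J \<longleftrightarrow> closed J \<and> csubspace J \<and> (\<exists>P. M_ideal_projection J P)"

text \<open>
  For an M-ideal \<open>J\<close> with projection \<open>P\<close>, the dual of \<open>J\<close> is identified, via unique norm-preserving
  extension, with the range of \<open>P\<close>.
\<close>

definition ideal_dual ::
    "(('a::complex_normed_vector \<Rightarrow>\<^sub>L complex) \<Rightarrow> ('a \<Rightarrow>\<^sub>L complex)) \<Rightarrow> ('a \<Rightarrow>\<^sub>L complex) set" where
  "ideal_dual P = P ` cdual"

definition unit_ball_of :: "'b::real_normed_vector set \<Rightarrow> 'b set" where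
  "unit_ball_of E = {f \<in> E. norm f \<le> 1}"

definition extreme_points :: "'b::real_vector set \<Rightarrow> 'b set" where
  "extreme_points C = {f. f extreme_point_of C}"

definition unit_interval_multiples :: "'b::real_vector set \<Rightarrow> 'b set" where
  "unit_interval_multiples S = {t *\<^sub>R s | t s. 0 \<le> t \<and> t \<le> 1 \<and> s \<in> S}"

end

theory Submission
  imports Defs
begin

text \<open>
  If \<open>infdist x J = 1\<close>, Hahn-Banach yields a state of \<open>x\<close> annihilating \<open>J\<close>. On the states of \<open>x\<close>
  the functional \<open>f \<mapsto> norm (P f)\<close> is affine, so the states outside \<open>annihilator J\<close> form a convex
  set \<open>U\<close>. Let \<open>K\<close> be the set of extreme points generating the states. Either of the two conditions
  keeps the weak-star closure of \<open>K\<close> inside \<open>U\<close>. By compactness \<open>K\<close> is covered by finitely many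
  slices \<open>1 \<le> Re (f j)\<close> with \<open>j\<close> in \<open>J\<close>. These are compact convex subsets of \<open>U\<close>, so the convex hull of
  their union is again a compact subset of \<open>U\<close>. It contains \<open>K\<close> and hence every state,
  a contradiction. This replaces the Krein-Milman and Milman theorems.
\<close>

section \<open>The Hahn-Banach theorem for sublinear functions\<close>

definition sublinear :: "('a::real_vector \<Rightarrow> real) \<Rightarrow> bool" where
  "sublinear p \<longleftrightarrow> (\<forall>x y. p (x + y) \<le> p x + p y) \<and> (\<forall>t x. 0 \<le> t \<longrightarrow> p (t *\<^sub>R x) = t * p x)"

lemma sublinear_add: "sublinear p \<Longrightarrow> p (x + y) \<le> p x + p y"
  and sublinear_scale: "sublinear p \<Longrightarrow> 0 \<le> t \<Longrightarrow> p (t *\<^sub>R x) = t * p x"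
  by (simp_all add: sublinear_def)

lemma sublinear_zero: "sublinear p \<Longrightarrow> p 0 = 0"
  using sublinear_scale[of p 0 0] by simp

lemma sublinear_minus: "sublinear p \<Longrightarrow> - p (- x) \<le> p x"
  using sublinear_add[of p x "- x"] sublinear_zero[of p] by simp

text \<open>One-sided homogeneity for positive factors is enough: applying it to
  \<open>inverse t\<close> and \<open>t *\<^sub>R x\<close> gives the reverse inequality, and
  \<open>p 0 = 0\<close> settles \<open>t = 0\<close>.\<close>

lemma sublinearI:
  assumes add: "\<And>x y. p (x + y) \<le> p x + p y"
    and scale: "\<And>t x. 0 < t \<Longrightarrow> p (t *\<^sub>R x) \<le> t * p x"
    and zero: "p 0 = 0"
  shows "sublinear p"
  unfolding sublinear_def
proof (intro conjI allI impI)
  fix t :: real and x :: 'a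
  assume "0 \<le> t"
  show "p (t *\<^sub>R x) = t * p x"
  proof (cases "t = 0")
    case False
    with \<open>0 \<le> t\<close> have t: "0 < t" by simp
    have "p (inverse t *\<^sub>R (t *\<^sub>R x)) \<le> inverse t * p (t *\<^sub>R x)"
      using t by (intro scale) simp
    with t have "t * p x \<le> p (t *\<^sub>R x)"
      by (simp add: field_simps)
    with scale[OF t, of x] show ?thesis by simp
  qed (simp add: zero)
qed (rule add)

text \<open>Pushing a sublinear function down in the direction \<open>z\<close> as far as sublinearity allows; a minimal
  sublinear function admits no such push and is therefore odd.\<close>

lemma sublinear_push_down:
  fixes p :: "'a::real_vector \<Rightarrow> real"
  assumes p: "sublinear p"
  obtains q where "sublinear q" "q \<le> p" "q (- z) \<le> - p z"
proof
  define q where "q = (\<lambda>y. INF t\<in>{0..}. p (y + t *\<^sub>R z) - t * p z)"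
  \<comment> \<open>This bound does not depend on \<open>t\<close>, so the infimum defining
    \<open>q\<close> is finite. It comes from writing \<open>t *\<^sub>R z\<close> as the sum of
    \<open>y + t *\<^sub>R z\<close> and \<open>- y\<close>.\<close>
  have lower: "- p (- y) \<le> p (y + t *\<^sub>R z) - t * p z" if "0 \<le> t" for y t
    using sublinear_add[OF p, of "y + t *\<^sub>R z" "- y"] sublinear_scale[OF p that, of z] by simp
  have bdd: "bdd_below ((\<lambda>t. p (y + t *\<^sub>R z) - t * p z) ` {0..})" for y
    using lower by (intro bdd_belowI2[where m = "- p (- y)"]) auto
  have q_le: "q y \<le> p (y + t *\<^sub>R z) - t * p z" if "0 \<le> t" for y t
    unfolding q_def using that by (intro cINF_lower[OF bdd]) auto
  have q_ge: "c \<le> q y" if "\<And>t. 0 \<le> t \<Longrightarrow> c \<le> p (y + t *\<^sub>R z) - t * p z" for c y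
    unfolding q_def using that by (intro cINF_greatest) auto
  show "q \<le> p"
    using q_le[of 0] by (simp add: le_fun_def)
  show "q (- z) \<le> - p z"
    using q_le[of 1 "- z"] sublinear_zero[OF p] by simp
  show "sublinear q"
  proof (rule sublinearI)
    fix x y
    \<comment> \<open>The two infima are treated one after the other: \<open>t\<close> is fixed for
      \<open>y\<close>, \<open>s\<close> runs over the parameters for \<open>x\<close>, and
      \<open>s + t\<close> is then admissible for \<open>x + y\<close>.\<close>
    have "q (x + y) - (p (y + t *\<^sub>R z) - t * p z) \<le> q x" if t: "0 \<le> t" for t
    proof (rule q_ge)
      fix s :: real assume s: "0 \<le> s"
      have "q (x + y) \<le> p ((x + y) + (s + t) *\<^sub>R z) - (s + t) * p z"
        using s t by (intro q_le) simp
      also have "\<dots> \<le> p (x + s *\<^sub>R z) + p (y + t *\<^sub>R z) - (s + t) * p z"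
        using sublinear_add[OF p, of "x + s *\<^sub>R z" "y + t *\<^sub>R z"] by (simp add: algebra_simps)
      finally show "q (x + y) - (p (y + t *\<^sub>R z) - t * p z) \<le> p (x + s *\<^sub>R z) - s * p z"
        by (simp add: algebra_simps)
    qed
    then have "q (x + y) - q x \<le> q y"
      by (intro q_ge) (simp add: algebra_simps)
    then show "q (x + y) \<le> q x + q y" by simp
  next
    fix t :: real and x assume t: "0 < t"
    have "q (t *\<^sub>R x) / t \<le> q x"
    proof (rule q_ge)
      fix s :: real assume s: "0 \<le> s"
      have "q (t *\<^sub>R x) \<le> p (t *\<^sub>R x + (t * s) *\<^sub>R z) - (t * s) * p z"
        using s t by (intro q_le) simp
      also have "\<dots> = t * (p (x + s *\<^sub>R z) - s * p z)"
        using sublinear_scale[OF p, of t "x + s *\<^sub>R z"] t by (simp add: algebra_simps)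
      finally show "q (t *\<^sub>R x) / t \<le> p (x + s *\<^sub>R z) - s * p z"
        using t by (simp add: field_simps)
    qed
    with t show "q (t *\<^sub>R x) \<le> t * q x" by (simp add: field_simps)
  next
    have "0 \<le> q 0"
      using sublinear_scale[OF p] by (intro q_ge) simp
    with q_le[of 0 0] sublinear_zero[OF p] show "q 0 = 0" by simp
  qed
qed

text \<open>The pointwise infimum works. Being a chain enters twice: comparison with one fixed
  member makes the infimum finite, and in the proof of subadditivity the smaller of two members
  serves both arguments.\<close>

lemma sublinear_chain_lower_bound:
  fixes C :: "('a::real_vector \<Rightarrow> real) set"
  assumes C: "C \<noteq> {}" "\<And>f. f \<in> C \<Longrightarrow> sublinear f"
    and chain: "\<And>f g. f \<in> C \<Longrightarrow> g \<in> C \<Longrightarrow> f \<le> g \<or> g \<le> f"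
  obtains u where "sublinear u" "\<And>f. f \<in> C \<Longrightarrow> u \<le> f"
proof
  define u where "u = (\<lambda>y. INF f\<in>C. f y)"
  obtain p where p: "p \<in> C" using C by auto
  have lower: "- p (- y) \<le> f y" if f: "f \<in> C" for f y
  proof -
    consider "f \<le> p" | "p \<le> f" using chain[OF f p] by blast
    then show ?thesis
    proof cases
      case 1
      then have "f (- y) \<le> p (- y)" by (simp add: le_fun_def)
      with sublinear_minus[of f y] C(2)[OF f] show ?thesis by simp
    next
      case 2
      then have "p y \<le> f y" by (simp add: le_fun_def)
      with sublinear_minus[of p y] C(2)[OF p] show ?thesis by simp
    qed
  qed
  have bdd: "bdd_below ((\<lambda>f. f y) ` C)" for y
    using lower by (intro bdd_belowI2) auto
  have u_le: "u y \<le> f y" if "f \<in> C" for f y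
    unfolding u_def using that by (intro cINF_lower[OF bdd])
  have u_ge: "c \<le> u y" if "\<And>f. f \<in> C \<Longrightarrow> c \<le> f y" for c y
    unfolding u_def using that C(1) by (intro cINF_greatest) auto
  show "u \<le> f" if "f \<in> C" for f
    using u_le[OF that] by (simp add: le_fun_def)
  show "sublinear u"
  proof (rule sublinearI)
    fix x y
    have "u (x + y) - g y \<le> u x" if g: "g \<in> C" for g
    proof (rule u_ge)
      fix f assume f: "f \<in> C"
      obtain h where h: "h \<in> C" "h \<le> f" "h \<le> g"
        using chain[OF f g] f g by blast
      then have "h x \<le> f x" "h y \<le> g y" by (simp_all add: le_fun_def)
      with u_le[OF h(1), of "x + y"] sublinear_add[OF C(2)[OF h(1)], of x y]
      show "u (x + y) - g y \<le> f x" by simp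
    qed
    then have "u (x + y) - u x \<le> u y"
      by (intro u_ge) (simp add: algebra_simps)
    then show "u (x + y) \<le> u x + u y" by simp
  next
    fix t :: real and x assume t: "0 < t"
    have "u (t *\<^sub>R x) / t \<le> u x"
    proof (rule u_ge)
      fix f assume f: "f \<in> C"
      show "u (t *\<^sub>R x) / t \<le> f x"
        using u_le[OF f, of "t *\<^sub>R x"] sublinear_scale[OF C(2)[OF f], of t x] t
        by (simp add: field_simps)
    qed
    with t show "u (t *\<^sub>R x) \<le> t * u x" by (simp add: field_simps)
  next
    have "0 \<le> u 0"
      using sublinear_zero C(2) by (intro u_ge) force
    with u_le[OF p, of 0] sublinear_zero[OF C(2)[OF p]] show "u 0 = 0" by simp
  qed
qed

text \<open>Zorn's lemma gives a minimal sublinear \<open>m\<close> below \<open>p\<close>. Pushing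
  \<open>m\<close> down along \<open>z\<close> cannot change it, so
  \<open>m (- z) \<le> - m z\<close>; hence \<open>m\<close> is odd, and an odd sublinear function
  is linear.\<close>

lemma linear_below_sublinear:
  fixes p :: "'a::real_vector \<Rightarrow> real"
  assumes p: "sublinear p"
  obtains l where "linear l" "l \<le> p"
proof -
  define A where "A = {q. sublinear q \<and> q \<le> p}"
  have "\<exists>m\<in>A. \<forall>a\<in>A. a \<le> m \<longrightarrow> a = m"
  proof (rule predicate_Zorn)
    \<comment> \<open>The order is reversed, so that the maximal element supplied by Zorn's lemma is
      a pointwise minimal one.\<close>
    show "partial_order_on A (relation_of (\<lambda>f g. g \<le> f) A)"
      by (rule partial_order_on_relation_ofI) auto
    fix C assume C: "C \<in> Chains (relation_of (\<lambda>f g. g \<le> f) A)"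
    show "\<exists>u\<in>A. \<forall>a\<in>C. u \<le> a"
    proof (cases "C = {}")
      case True
      with p show ?thesis by (auto simp: A_def)
    next
      case False
      have CA: "C \<subseteq> A" and chain: "\<And>f g. f \<in> C \<Longrightarrow> g \<in> C \<Longrightarrow> f \<le> g \<or> g \<le> f"
        using C by (auto simp: Chains_def relation_of_def)
      obtain u where u: "sublinear u" "\<And>f. f \<in> C \<Longrightarrow> u \<le> f"
        using sublinear_chain_lower_bound[OF False _ chain] CA by (auto simp: A_def)
      obtain f where "f \<in> C" using False by blast
      with u(2) CA have "u \<le> p" unfolding A_def using order_trans by blast
      with u show ?thesis by (auto simp: A_def)
    qed
  qed
  then obtain m where m: "sublinear m" "m \<le> p"
    and min: "\<And>q. sublinear q \<Longrightarrow> q \<le> m \<Longrightarrow> q = m"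
    unfolding A_def using order_trans by blast
  have odd: "m (- z) = - m z" for z
  proof -
    obtain q where "sublinear q" "q \<le> m" "q (- z) \<le> - m z"
      using sublinear_push_down[OF m(1)] .
    with min[of q] sublinear_minus[OF m(1), of z] show ?thesis by simp
  qed
  have "linear m"
  proof (rule linearI)
    fix x y
    show "m (x + y) = m x + m y"
      using sublinear_add[OF m(1), of x y] sublinear_add[OF m(1), of "- x" "- y"] odd[of "x + y"]
      by (simp add: odd)
  next
    fix t x
    show "m (t *\<^sub>R x) = t *\<^sub>R m x"
    proof (cases "0 \<le> t")
      case True
      then show ?thesis by (simp add: sublinear_scale[OF m(1)])
    next
      case False
      then show ?thesis
        using sublinear_scale[OF m(1), of "- t" x] odd[of "t *\<^sub>R x"] by simp
    qed
  qed
  then show thesis using m(2) by (rule that)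
qed

text \<open>Pushing \<open>p\<close> down along \<open>x\<close> first forces every linear
  \<open>l\<close> below the result to satisfy \<open>l (- x) \<le> - p x\<close>, which is the
  missing inequality \<open>p x \<le> l x\<close>.\<close>

lemma Hahn_Banach_sublinear:
  fixes p :: "'a::real_vector \<Rightarrow> real"
  assumes p: "sublinear p"
  obtains l where "linear l" "l \<le> p" "l x = p x"
proof -
  obtain q where q: "sublinear q" "q \<le> p" "q (- x) \<le> - p x"
    using sublinear_push_down[OF p] .
  obtain l where l: "linear l" "l \<le> q"
    using linear_below_sublinear[OF q(1)] .
  have "l (- x) \<le> - p x" using l(2) q(3) by (auto simp: le_fun_def intro: order_trans)
  then have "p x \<le> l x" using linear_neg[OF l(1), of x] by simp
  moreover have lp: "l \<le> p" using l(2) q(2) by (rule order_trans)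
  ultimately show thesis using l(1) that[of l] by (auto simp: le_fun_def intro: antisym)
qed

section \<open>The weak-star topology\<close>

lemma continuous_map_weak_star:
  assumes "f \<in> topspace T \<rightarrow> F"
    and "\<And>y. y \<in> J \<Longrightarrow> continuous_map T euclidean (\<lambda>z. blinfun_apply (f z) y)"
  shows "continuous_map T (weak_star_topology F J) f"
  unfolding weak_star_topology_def
proof (rule continuous_map_pullback')
  show "continuous_map T (product_topology (\<lambda>_. euclidean) J) ((\<lambda>g. restrict (blinfun_apply g) J) \<circ> f)"
    using assms(2) by (auto simp: continuous_map_componentwise)
  show "topspace T \<subseteq> f -` F"
    using assms(1) by auto
qed

lemma continuous_map_weak_star_apply:
  assumes "y \<in> J"
  shows "continuous_map (weak_star_topology F J) euclidean (\<lambda>f. blinfun_apply f y)"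
proof -
  have "continuous_map (weak_star_topology F J) euclidean ((\<lambda>\<phi>. \<phi> y) \<circ> (\<lambda>f. restrict (blinfun_apply f) J))"
    unfolding weak_star_topology_def
    by (intro continuous_map_pullback continuous_map_product_projection assms)
  then show ?thesis using assms by (simp add: o_def)
qed

lemma Hausdorff_weak_star: "Hausdorff_space (weak_star_topology F UNIV)"
  unfolding Hausdorff_space_def
proof (intro allI impI)
  fix f g
  assume *: "f \<in> topspace (weak_star_topology F UNIV) \<and> g \<in> topspace (weak_star_topology F UNIV) \<and> f \<noteq> g"
  then obtain y where "blinfun_apply f y \<noteq> blinfun_apply g y"
    using blinfun_eqI by blast
  then obtain U V where UV: "open U" "open V" "blinfun_apply f y \<in> U" "blinfun_apply g y \<in> V" "U \<inter> V = {}"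
    by (meson hausdorff)
  have "openin (weak_star_topology F UNIV) {h \<in> topspace (weak_star_topology F UNIV). blinfun_apply h y \<in> W}"
    if "open W" for W
    using openin_continuous_map_preimage[OF continuous_map_weak_star_apply[of y UNIV F], of W] that
    by simp
  from this[OF UV(1)] this[OF UV(2)] show "\<exists>U V. openin (weak_star_topology F UNIV) U \<and> openin (weak_star_topology F UNIV) V \<and>
      f \<in> U \<and> g \<in> V \<and> disjnt U V"
    using UV(3-5) * unfolding disjnt_def by (intro exI conjI) (assumption | auto)+
qed

section \<open>Real-linear structure of the complex dual; convexity and compactness of the state
  set\<close>

lemma scale_functional_of_real: "scale_functional (complex_of_real t) f = t *\<^sub>R f"
  by (rule blinfun_eqI) (simp add: scaleR_blinfun.rep_eq scaleR_conv_of_real)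

lemma cdual_add: "f \<in> cdual \<Longrightarrow> g \<in> cdual \<Longrightarrow> f + g \<in> cdual"
  by (simp add: cdual_def plus_blinfun.rep_eq algebra_simps)

lemma cdual_diff: "f \<in> cdual \<Longrightarrow> g \<in> cdual \<Longrightarrow> f - g \<in> cdual"
  by (simp add: cdual_def minus_blinfun.rep_eq algebra_simps)

lemma cdual_scaleR: "f \<in> cdual \<Longrightarrow> t *\<^sub>R f \<in> cdual"
  by (simp add: cdual_def scaleR_blinfun.rep_eq)

text \<open>The value 1 at a unit vector already forces norm at least 1. Replacing the norm equation
  by an inequality exposes the state set as convex and weak-star closed.\<close>

lemma state_set_unit_eq:
  assumes "norm x = 1"
  shows "state_set x = {f \<in> cdual. norm f \<le> 1 \<and> blinfun_apply f x = 1}"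
proof -
  have "1 \<le> norm f" if "blinfun_apply f x = 1" for f :: "'a \<Rightarrow>\<^sub>L complex"
    using norm_blinfun[of f x] assms that by simp
  then show ?thesis using assms by (force simp: state_set_def)
qed

lemma convex_state_set:
  assumes "norm x = 1"
  shows "convex (state_set x)"
proof (rule convexI)
  fix f g :: "'a \<Rightarrow>\<^sub>L complex" and u v :: real
  assume fg: "f \<in> state_set x" "g \<in> state_set x" and uv: "0 \<le> u" "0 \<le> v" "u + v = 1"
  have "norm (u *\<^sub>R f + v *\<^sub>R g) \<le> u * norm f + v * norm g"
    using norm_triangle_ineq[of "u *\<^sub>R f" "v *\<^sub>R g"] uv by simp
  also have "\<dots> \<le> 1"
    using fg uv by (simp add: state_set_def)
  finally have "norm (u *\<^sub>R f + v *\<^sub>R g) \<le> 1" .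
  moreover have "complex_of_real u + complex_of_real v = 1"
    using uv by (metis of_real_1 of_real_add)
  ultimately show "u *\<^sub>R f + v *\<^sub>R g \<in> state_set x"
    using fg assms
    by (auto simp: state_set_unit_eq cdual_add cdual_scaleR plus_blinfun.rep_eq scaleR_blinfun.rep_eq
        scaleR_conv_of_real)
qed

text \<open>The Banach-Alaoglu argument: states correspond to points of a product of discs, compact
  by Tychonoff, that satisfy linearity and the value 1 at \<open>x\<close>; these are equations
  between continuous coordinate maps, hence closed conditions.\<close>

lemma compactin_state_set:
  fixes x :: "'a::complex_normed_vector"
  assumes x: "norm x = 1"
  shows "compactin (weak_star_topology cdual UNIV) (state_set x)"
proof -
  define T where "T = product_topology (\<lambda>_::'a. euclidean :: complex topology) UNIV"
  \<comment> \<open>The radius \<open>norm y\<close> in coordinate \<open>y\<close> encodes operator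
    norm at most 1.\<close>
  define \<Phi> where "\<Phi> = {\<phi> \<in> (\<Pi>\<^sub>E y\<in>UNIV. cball 0 (norm y)). (\<forall>y z. \<phi> (y + z) = \<phi> y + \<phi> z) \<and>
      (\<forall>c y. \<phi> (c *\<^sub>C y) = c * \<phi> y) \<and> \<phi> x = 1}"
  have coord: "continuous_map T euclidean (\<lambda>\<phi>. \<phi> y)" for y
    unfolding T_def by (rule continuous_map_product_projection) simp
  have mult: "continuous_map T euclidean (\<lambda>\<phi>. c * \<phi> y)" for c y
    using coord[of y] by (simp add: continuous_map_atin tendsto_mult_left)
  have closed: "closedin T {\<phi> \<in> topspace T. a \<phi> = b \<phi>}"
    if "continuous_map T euclidean a" "continuous_map T euclidean b" for a b :: "('a \<Rightarrow> complex) \<Rightarrow> complex"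
    using closedin_continuous_maps_eq[OF Hausdorff_space_euclidean] that by blast
  have "compactin T (\<Pi>\<^sub>E y\<in>UNIV. cball 0 (norm y))"
    unfolding T_def by (simp add: compactin_PiE)
  moreover have "closedin T ((\<Inter>y. \<Inter>z. {\<phi> \<in> topspace T. \<phi> (y + z) = \<phi> y + \<phi> z}) \<inter>
      (\<Inter>c. \<Inter>y. {\<phi> \<in> topspace T. \<phi> (c *\<^sub>C y) = c * \<phi> y}) \<inter> {\<phi> \<in> topspace T. \<phi> x = 1})"
    by (intro closedin_Int closedin_Inter closed)
      (auto intro!: closedin_Inter closed continuous_intros coord mult)
  ultimately have "compactin T ((\<Pi>\<^sub>E y\<in>UNIV. cball 0 (norm y)) \<inter>
      ((\<Inter>y. \<Inter>z. {\<phi> \<in> topspace T. \<phi> (y + z) = \<phi> y + \<phi> z}) \<inter>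
      (\<Inter>c. \<Inter>y. {\<phi> \<in> topspace T. \<phi> (c *\<^sub>C y) = c * \<phi> y}) \<inter> {\<phi> \<in> topspace T. \<phi> x = 1}))"
    by (rule compact_Int_closedin)
  also have "(\<Pi>\<^sub>E y\<in>UNIV. cball 0 (norm y)) \<inter>
      ((\<Inter>y. \<Inter>z. {\<phi> \<in> topspace T. \<phi> (y + z) = \<phi> y + \<phi> z}) \<inter>
      (\<Inter>c. \<Inter>y. {\<phi> \<in> topspace T. \<phi> (c *\<^sub>C y) = c * \<phi> y}) \<inter> {\<phi> \<in> topspace T. \<phi> x = 1}) = \<Phi>"
    by (auto simp: \<Phi>_def T_def)
  finally have "compactin T \<Phi>" .
  have Blinfun: "blinfun_apply (Blinfun \<phi>) = \<phi>" "Blinfun \<phi> \<in> state_set x" if "\<phi> \<in> \<Phi>" for \<phi>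
  proof -
    have bl: "bounded_linear \<phi>"
    proof (rule bounded_linear_intro[where K = 1])
      show "\<phi> (r *\<^sub>R y) = r *\<^sub>R \<phi> y" for r y
        using that by (metis (mono_tags, lifting) \<Phi>_def mem_Collect_eq scaleC_of_real scaleR_conv_of_real)
    qed (use that in \<open>auto simp: \<Phi>_def PiE_iff\<close>)
    then show *: "blinfun_apply (Blinfun \<phi>) = \<phi>" by (rule bounded_linear_Blinfun_apply)
    have "norm (Blinfun \<phi>) \<le> 1"
      using that by (intro norm_blinfun_bound) (auto simp: * \<Phi>_def PiE_iff)
    then show "Blinfun \<phi> \<in> state_set x"
      using that x by (auto simp: state_set_unit_eq cdual_def * \<Phi>_def)
  qed
  have "state_set x = Blinfun ` \<Phi>"
  proof (intro equalityI subsetI)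
    fix f assume f: "f \<in> state_set x"
    have "norm (blinfun_apply f y) \<le> norm y" for y
      using norm_blinfun[of f y] f by (simp add: state_set_def)
    then have "blinfun_apply f \<in> \<Phi>"
      using f x by (auto simp: \<Phi>_def state_set_def cdual_def blinfun.add_right)
    then show "f \<in> Blinfun ` \<Phi>"
      by (metis blinfun_apply_inverse image_eqI)
  qed (use Blinfun in auto)
  \<comment> \<open>On \<open>\<Phi>\<close>, evaluating \<open>Blinfun \<phi>\<close> at
    \<open>y\<close> is just reading off coordinate \<open>y\<close>.\<close>
  moreover have "continuous_map (subtopology T \<Phi>) (weak_star_topology cdual UNIV) Blinfun"
  proof (rule continuous_map_weak_star)
    show "Blinfun \<in> topspace (subtopology T \<Phi>) \<rightarrow> cdual"
      using Blinfun(2) by (auto simp: state_set_def)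
    show "continuous_map (subtopology T \<Phi>) euclidean (\<lambda>\<phi>. blinfun_apply (Blinfun \<phi>) y)" for y
      using Blinfun(1)
      by (intro continuous_map_eq[OF continuous_map_from_subtopology[OF coord[of y]]]) auto
  qed
  ultimately show ?thesis
    using image_compactin[of "subtopology T \<Phi>" \<Phi> _ Blinfun] \<open>compactin T \<Phi>\<close>
    by (simp add: compactin_subtopology)
qed

section \<open>Convex hulls of finite unions of compact convex sets\<close>

text \<open>Merges two points of a convex set under weights that need not sum to one. When both
  weights vanish, any point of the set will do.\<close>

lemma convex_scaleR_add_scaleR:
  assumes "convex A" "a \<in> A" "b \<in> A" "0 \<le> u" "0 \<le> v"
  obtains c where "c \<in> A" "u *\<^sub>R a + v *\<^sub>R b = (u + v) *\<^sub>R c"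
proof (cases "u + v = 0")
  case True
  with assms have "u = 0" "v = 0" by linarith+
  with assms(2) show thesis by (intro that[of a]) auto
next
  case False
  with assms have "0 < u + v" by linarith
  then show thesis
    using mem_convex_alt[OF assms] False
    by (intro that[of "(u/(u+v)) *\<^sub>R a + (v/(u+v)) *\<^sub>R b"]) (auto simp: scaleR_add_right)
qed

text \<open>In a convex combination of two points of the join, the terms from \<open>A\<close> and
  those from \<open>B\<close> are collected separately; each group merges into one point, and the
  total weights again sum to 1.\<close>

lemma convex_join:
  assumes "convex A" "convex B"
  shows "convex ((\<lambda>(t, a, b). (1 - t) *\<^sub>R a + t *\<^sub>R b) ` ({0..1} \<times> A \<times> B))" (is "convex ?D")
proof (rule convexI)
  fix f g and u v :: real
  assume f: "f \<in> ?D" and g: "g \<in> ?D" and uv: "0 \<le> u" "0 \<le> v" "u + v = 1"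
  from f obtain s a b where s: "0 \<le> s" "s \<le> 1" and ab: "a \<in> A" "b \<in> B" and f: "f = (1 - s) *\<^sub>R a + s *\<^sub>R b"
    by auto
  from g obtain t a' b' where t: "0 \<le> t" "t \<le> 1" and ab': "a' \<in> A" "b' \<in> B" and g: "g = (1 - t) *\<^sub>R a' + t *\<^sub>R b'"
    by auto
  obtain c where c: "c \<in> A" "(u * (1 - s)) *\<^sub>R a + (v * (1 - t)) *\<^sub>R a' = (u * (1 - s) + v * (1 - t)) *\<^sub>R c"
    using convex_scaleR_add_scaleR[OF assms(1) ab(1) ab'(1), of "u * (1 - s)" "v * (1 - t)"] s t uv by auto
  obtain d where d: "d \<in> B" "(u * s) *\<^sub>R b + (v * t) *\<^sub>R b' = (u * s + v * t) *\<^sub>R d"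
    using convex_scaleR_add_scaleR[OF assms(2) ab(2) ab'(2), of "u * s" "v * t"] s t uv by auto
  have "u * s + v * t \<le> u * 1 + v * 1"
    using s t uv by (intro add_mono mult_left_mono) auto
  then have r: "u * s + v * t \<in> {0..1}"
    using s t uv by simp
  have w: "u * (1 - s) + v * (1 - t) = 1 - (u * s + v * t)"
    using uv by (simp add: algebra_simps)
  have "u *\<^sub>R f + v *\<^sub>R g = ((u * (1 - s)) *\<^sub>R a + (v * (1 - t)) *\<^sub>R a') + ((u * s) *\<^sub>R b + (v * t) *\<^sub>R b')"
    unfolding f g by (simp add: scaleR_add_right add_ac)
  also have "\<dots> = (1 - (u * s + v * t)) *\<^sub>R c + (u * s + v * t) *\<^sub>R d"
    unfolding c(2) d(2) w ..
  finally show "u *\<^sub>R f + v *\<^sub>R g \<in> ?D"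
    using r c(1) d(1) by (intro image_eqI[of _ _ "(u * s + v * t, c, d)"]) auto
qed

text \<open>The join is the image of a compact product under a map whose joint weak-star continuity
  can be tested at each evaluation.\<close>

lemma compactin_join:
  assumes A: "compactin (weak_star_topology cdual UNIV) A"
    and B: "compactin (weak_star_topology cdual UNIV) B"
  shows "compactin (weak_star_topology cdual UNIV)
           ((\<lambda>(t, a, b). (1 - t) *\<^sub>R a + t *\<^sub>R b) ` ({0..1} \<times> A \<times> B))"
proof (rule image_compactin)
  let ?W = "weak_star_topology cdual UNIV :: ('a \<Rightarrow>\<^sub>L complex) topology"
  let ?T = "prod_topology (euclidean :: real topology) (prod_topology ?W ?W)"
  show "compactin ?T ({0..1} \<times> A \<times> B)"
    using A B by (simp add: compactin_Times)
  show "continuous_map ?T ?W (\<lambda>(t, a, b). (1 - t) *\<^sub>R a + t *\<^sub>R b)"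
  proof (rule continuous_map_weak_star)
    show "(\<lambda>(t, a, b). (1 - t) *\<^sub>R a + t *\<^sub>R b) \<in> topspace ?T \<rightarrow> cdual"
      by (auto intro: cdual_add cdual_scaleR)
    fix y
    have fst: "continuous_map ?T euclidean fst"
      by (rule continuous_map_fst)
    have a: "continuous_map ?T euclidean (\<lambda>z. blinfun_apply (fst (snd z)) y)"
      using continuous_map_compose[OF continuous_map_compose[OF continuous_map_snd continuous_map_fst]
          continuous_map_weak_star_apply[of y UNIV cdual]] by (simp add: o_def)
    have b: "continuous_map ?T euclidean (\<lambda>z. blinfun_apply (snd (snd z)) y)"
      using continuous_map_compose[OF continuous_map_compose[OF continuous_map_snd continuous_map_snd]
          continuous_map_weak_star_apply[of y UNIV cdual]] by (simp add: o_def)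
    have scale: "continuous_map ?T euclidean (\<lambda>z. r z *\<^sub>R h z)"
      if "continuous_map ?T euclidean r" "continuous_map ?T euclidean h" for r and h :: "_ \<Rightarrow> complex"
      using that by (simp add: continuous_map_atin tendsto_scaleR)
    show "continuous_map ?T euclidean
        (\<lambda>z. blinfun_apply ((\<lambda>(t, a, b). (1 - t) *\<^sub>R a + t *\<^sub>R b) z) y)"
      by (simp add: case_prod_unfold plus_blinfun.rep_eq scaleR_blinfun.rep_eq)
        (intro continuous_map_add continuous_map_diff scale continuous_map_const[THEN iffD2] a b fst, simp)
  qed
qed

text \<open>Induction on the finite family, joining one set at a time to the cover found so far.
  Convexity of \<open>U\<close> keeps each join inside it.\<close>

lemma compact_convex_cover:
  fixes U :: "('a::complex_normed_vector \<Rightarrow>\<^sub>L complex) set"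
  assumes "finite \<C>" "convex U"
    and "\<And>C. C \<in> \<C> \<Longrightarrow> compactin (weak_star_topology cdual UNIV) C \<and> convex C \<and> C \<subseteq> U"
  shows "\<exists>D. compactin (weak_star_topology cdual UNIV) D \<and> convex D \<and> D \<subseteq> U \<and> \<Union>\<C> \<subseteq> D"
  using assms(1,3)
proof (induction \<C>)
  case empty
  show ?case by (intro exI[of _ "{}"]) auto
next
  case (insert C \<C>)
  then obtain D where D: "compactin (weak_star_topology cdual UNIV) D" "convex D" "D \<subseteq> U" "\<Union>\<C> \<subseteq> D"
    by blast
  have C: "compactin (weak_star_topology cdual UNIV) C" "convex C" "C \<subseteq> U"
    using insert.prems by auto
  show ?case
  \<comment> \<open>A join with an empty set is empty and would lose the other set, so this case
    uses the union instead.\<close>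
  proof (cases "C = {} \<or> D = {}")
    case True
    then have "compactin (weak_star_topology cdual UNIV) (C \<union> D)" "convex (C \<union> D)"
      using C D by auto
    then show ?thesis
      using C(3) D(3,4) by (intro exI[of _ "C \<union> D"]) auto
  next
    case False
    let ?E = "(\<lambda>(t, a, b). (1 - t) *\<^sub>R a + t *\<^sub>R b) ` ({0..1::real} \<times> C \<times> D)"
    have "?E \<subseteq> U"
      using C(3) D(3) \<open>convex U\<close>[unfolded convex_alt] by (auto dest!: subsetD)
    moreover have "c \<in> ?E" if "c \<in> C" for c
      using that False by (force intro: image_eqI[of _ _ "(0, c, _)"])
    moreover have "d \<in> ?E" if "d \<in> D" for d
      using that False by (force intro: image_eqI[of _ _ "(1, _, d)"])
    ultimately have "?E \<subseteq> U" "\<Union>(insert C \<C>) \<subseteq> ?E"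
      using D(4) by auto
    then show ?thesis
      using convex_join[OF C(2) D(2)] compactin_join[OF C(1) D(1)] by (intro exI[of _ ?E]) simp
  qed
qed

section \<open>States and M-ideals\<close>

text \<open>The distance to \<open>J\<close> is the quotient seminorm, hence sublinear. A real
  functional below it that attains it at \<open>x\<close> is complexified; domination by the
  distance gives both norm at most 1 and vanishing on \<open>J\<close>.\<close>

lemma infdist_attaining_annihilator:
  fixes x :: "'a::complex_normed_vector"
  assumes J: "csubspace J" and x: "norm x = 1" "infdist x J = 1"
  obtains f where "f \<in> state_set x" "f \<in> annihilator J"
proof -
  have J0: "0 \<in> J" and J_add: "\<And>y z. y \<in> J \<Longrightarrow> z \<in> J \<Longrightarrow> y + z \<in> J"
    and J_scale: "\<And>c y. y \<in> J \<Longrightarrow> c *\<^sub>C y \<in> J"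
    using J by (auto simp: csubspace_def)
  define p where "p = (\<lambda>y. infdist y J)"
  have ge: "c \<le> p y" if "\<And>j. j \<in> J \<Longrightarrow> c \<le> norm (y - j)" for c y
    using that J0 unfolding p_def infdist_def by (auto intro!: cINF_greatest simp: dist_norm)
  have le: "p y \<le> norm (y - j)" if "j \<in> J" for y j
    unfolding p_def dist_norm[symmetric] by (rule infdist_le[OF that])
  have p0: "p j = 0" if "j \<in> J" for j
    using that by (simp add: p_def)
  have p_le: "p y \<le> norm y" for y
    using le[OF J0, of y] by simp
  have "sublinear p"
  proof (rule sublinearI)
    fix y z
    have "p (y + z) - norm (y - j) \<le> p z" if j: "j \<in> J" for j
    proof (rule ge)
      fix k assume k: "k \<in> J"
      have "p (y + z) \<le> norm ((y - j) + (z - k))"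
        using le[OF J_add[OF j k], of "y + z"] by (simp add: algebra_simps)
      also have "\<dots> \<le> norm (y - j) + norm (z - k)"
        by (rule norm_triangle_ineq)
      finally show "p (y + z) - norm (y - j) \<le> norm (z - k)" by simp
    qed
    then have "p (y + z) - p z \<le> p y"
      by (intro ge) (simp add: algebra_simps)
    then show "p (y + z) \<le> p y + p z" by simp
  next
    fix t :: real and y assume t: "0 < t"
    have "p (t *\<^sub>R y) / t \<le> p y"
    proof (rule ge)
      fix j assume "j \<in> J"
      then have "p (t *\<^sub>R y) \<le> norm (t *\<^sub>R y - t *\<^sub>R j)"
        using J_scale[of j "complex_of_real t"] by (intro le) (simp add: scaleC_of_real)
      also have "\<dots> = t * norm (y - j)"
        using t by (simp flip: scaleR_diff_right)
      finally show "p (t *\<^sub>R y) / t \<le> norm (y - j)"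
        using t by (simp add: field_simps)
    qed
    with t show "p (t *\<^sub>R y) \<le> t * p y" by (simp add: field_simps)
  qed (simp add: p0 J0)
  then obtain l where l: "linear l" "l \<le> p" "l x = p x"
    by (rule Hahn_Banach_sublinear)
  have l_le: "l y \<le> p y" for y
    using l(2) by (simp add: le_fun_def)
  have l_add: "l (y + z) = l y + l z" and l_scale: "l (r *\<^sub>R y) = r * l y" for y z r
    using linear_add[OF l(1)] linear_scale[OF l(1)] by auto
  have l_complex: "l (c *\<^sub>C y) = Re c * l y + Im c * l (\<i> *\<^sub>C y)" for c y
  proof -
    have "c *\<^sub>C y = Re c *\<^sub>R y + Im c *\<^sub>R (\<i> *\<^sub>C y)"
      by (simp add: scaleC_scaleC mult.commute flip: scaleC_of_real scaleC_add_left complex_eq)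
    then show ?thesis by (simp add: l_add l_scale)
  qed
  \<comment> \<open>The standard complex-linear functional whose real part is
    \<open>l\<close>.\<close>
  define \<phi> where "\<phi> = (\<lambda>y. Complex (l y) (- l (\<i> *\<^sub>C y)))"
  have ii: "l (\<i> *\<^sub>C \<i> *\<^sub>C y) = - l y" for y
    using l_complex[of "-1" y] by (simp add: scaleC_scaleC)
  have \<phi>_scale: "\<phi> (c *\<^sub>C y) = c * \<phi> y" for c y
  proof -
    have "l (\<i> *\<^sub>C c *\<^sub>C y) = Re c * l (\<i> *\<^sub>C y) - Im c * l y"
      using l_complex[of c "\<i> *\<^sub>C y"] by (simp add: ii) (simp add: scaleC_scaleC mult.commute)
    then show ?thesis
      unfolding \<phi>_def by (simp add: l_complex[of c y] complex_eq_iff algebra_simps)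
  qed
  have \<phi>_bound: "norm (\<phi> y) \<le> p y" for y
  proof (cases "\<phi> y = 0")
    case True
    then show ?thesis using infdist_nonneg by (simp add: p_def)
  next
    case False
    \<comment> \<open>A unimodular rotation makes \<open>\<phi> (u *\<^sub>C y)\<close> real and
      nonnegative, so that only its real part \<open>l\<close> needs bounding. The rotation does not
      increase the distance because \<open>J\<close> is invariant under complex scalars.\<close>
    define u where "u = cnj (\<phi> y) / norm (\<phi> y)"
    have u: "norm u = 1" "u * \<phi> y = norm (\<phi> y)"
      using False by (auto simp: u_def norm_divide mult.commute[of "cnj _"] complex_norm_square[symmetric]
          power2_eq_square)
    have "norm (\<phi> y) = Re (\<phi> (u *\<^sub>C y))"
      by (simp add: \<phi>_scale u(2))
    also have "\<dots> \<le> p (u *\<^sub>C y)"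
      using l_le by (simp add: \<phi>_def)
    also have "\<dots> \<le> p y"
    proof (rule ge)
      fix j assume "j \<in> J"
      then have "p (u *\<^sub>C y) \<le> norm (u *\<^sub>C y - u *\<^sub>C j)"
        by (intro le J_scale)
      also have "u *\<^sub>C y - u *\<^sub>C j = u *\<^sub>C (y - j)"
        using scaleC_add_right[of u "y - j" j] by (simp add: algebra_simps)
      finally show "p (u *\<^sub>C y) \<le> norm (y - j)" by (simp add: norm_scaleC u(1))
    qed
    finally show ?thesis .
  qed
  have "bounded_linear \<phi>"
  proof (rule bounded_linear_intro[where K = 1])
    show "\<phi> (y + z) = \<phi> y + \<phi> z" for y z
      by (simp add: \<phi>_def scaleC_add_right l_add complex_eq_iff)
    show "\<phi> (r *\<^sub>R y) = r *\<^sub>R \<phi> y" for r y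
      using \<phi>_scale[of "complex_of_real r" y] by (simp add: scaleC_of_real scaleR_conv_of_real)
    show "norm (\<phi> y) \<le> norm y * 1" for y
      using \<phi>_bound[of y] p_le[of y] by simp
  qed
  then have Bl: "blinfun_apply (Blinfun \<phi>) = \<phi>"
    by (rule bounded_linear_Blinfun_apply)
  have "norm (Blinfun \<phi>) \<le> 1"
    using \<phi>_bound p_le by (intro norm_blinfun_bound) (auto simp: Bl intro: order_trans)
  \<comment> \<open>Real part 1 together with modulus at most 1 leaves no room for an imaginary
    part.\<close>
  moreover have "\<phi> x = 1"
  proof -
    have "Re (\<phi> x) = 1" using l(3) x(2) by (simp add: \<phi>_def p_def)
    moreover have "norm (\<phi> x) \<le> 1" using \<phi>_bound[of x] x(2) by (simp add: p_def)
    then have "(Re (\<phi> x))\<^sup>2 + (Im (\<phi> x))\<^sup>2 \<le> 1"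
      by (simp add: cmod_def)
    ultimately show ?thesis by (simp add: complex_eq_iff)
  qed
  moreover have "Blinfun \<phi> \<in> cdual"
    by (simp add: cdual_def Bl \<phi>_scale)
  moreover have "\<phi> j = 0" if "j \<in> J" for j
    using \<phi>_bound[of j] p0[OF that] by simp
  ultimately show thesis
    by (intro that[of "Blinfun \<phi>"]) (auto simp: state_set_unit_eq[OF x(1)] annihilator_def Bl)
qed

section \<open>The L-projection of an M-ideal and its action on states\<close>

lemma M_ideal_projectionD:
  assumes "M_ideal_projection J P"
  shows "\<And>f. f \<in> cdual \<Longrightarrow> P f \<in> cdual"
    and "\<And>f g. f \<in> cdual \<Longrightarrow> g \<in> cdual \<Longrightarrow> P (f + g) = P f + P g"
    and "\<And>t f. f \<in> cdual \<Longrightarrow> P (t *\<^sub>R f) = t *\<^sub>R P f"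
    and "\<And>f. f \<in> cdual \<Longrightarrow> P (P f) = P f"
    and "\<And>f. f \<in> cdual \<Longrightarrow> norm f = norm (P f) + norm (f - P f)"
    and "\<And>f. f \<in> annihilator J \<longleftrightarrow> f \<in> cdual \<and> P f = 0"
proof -
  show "\<And>f. f \<in> annihilator J \<longleftrightarrow> f \<in> cdual \<and> P f = 0"
    using assms by (auto simp: M_ideal_projection_def)
  show "\<And>t f. f \<in> cdual \<Longrightarrow> P (t *\<^sub>R f) = t *\<^sub>R P f"
    using assms by (simp add: M_ideal_projection_def L_projection_def flip: scale_functional_of_real)
qed (use assms in \<open>unfold M_ideal_projection_def L_projection_def, blast+\<close>)

lemma ideal_dual_subset: "M_ideal_projection J P \<Longrightarrow> ideal_dual P \<subseteq> cdual"
  using M_ideal_projectionD(1) by (auto simp: ideal_dual_def)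

lemma projection_ideal_dual: "M_ideal_projection J P \<Longrightarrow> f \<in> ideal_dual P \<Longrightarrow> P f = f"
  using M_ideal_projectionD(4) by (auto simp: ideal_dual_def)

text \<open>Idempotence puts \<open>f - P f\<close> in the kernel of \<open>P\<close>, which is the
  annihilator of \<open>J\<close>.\<close>

lemma M_ideal_projection_agrees:
  assumes P: "M_ideal_projection J P" and f: "f \<in> cdual" and j: "j \<in> J"
  shows "blinfun_apply (P f) j = blinfun_apply f j"
proof -
  have "P ((f - P f) + P f) = P (f - P f) + P (P f)"
    using M_ideal_projectionD(1,2)[OF P] f cdual_diff by blast
  then have "P (f - P f) = 0"
    using M_ideal_projectionD(4)[OF P f] by simp
  then have "f - P f \<in> annihilator J"
    using M_ideal_projectionD(1,6)[OF P] f cdual_diff by blast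
  with j show ?thesis
    by (simp add: annihilator_def minus_blinfun.rep_eq)
qed

text \<open>On the states of a unit vector the seminorm \<open>norm (P f)\<close> is affine, because it
  equals the evaluation of \<open>P f\<close> at the vector.\<close>

lemma norm_projection_state:
  assumes P: "M_ideal_projection J P" and x: "norm x = 1" and f: "f \<in> state_set x"
  shows "Re (blinfun_apply (P f) x) = norm (P f)"
proof -
  have Re_le: "Re (blinfun_apply g x) \<le> norm g" for g :: "'a \<Rightarrow>\<^sub>L complex"
    using complex_Re_le_cmod[of "blinfun_apply g x"] norm_blinfun[of g x] x by simp
  have "f \<in> cdual" using f by (simp add: state_set_def)
  then have "norm f = norm (P f) + norm (f - P f)"
    by (rule M_ideal_projectionD(5)[OF P])
  \<comment> \<open>The two values sum to 1, as do the two norms, and each value is at most the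
    corresponding norm. Hence both inequalities are equalities.\<close>
  moreover have "Re (blinfun_apply (P f) x) + Re (blinfun_apply (f - P f) x) = 1" "norm f = 1"
    using f x by (simp_all add: state_set_def minus_blinfun.rep_eq)
  ultimately show ?thesis
    using Re_le[of "P f"] Re_le[of "f - P f"] by linarith
qed

text \<open>A state lies outside the annihilator exactly when \<open>norm (P f)\<close> is positive.
  On states this norm is \<open>Re (blinfun_apply (P f) x)\<close>, which is real-linear in
  \<open>f\<close>, so the condition is a strict half-space condition.\<close>

lemma convex_state_set_minus_annihilator:
  assumes P: "M_ideal_projection J P" and x: "norm x = 1"
  shows "convex (state_set x - annihilator J)"
proof -
  have mem: "f \<in> state_set x - annihilator J \<longleftrightarrow> f \<in> state_set x \<and> 0 < Re (blinfun_apply (P f) x)" for f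
    using norm_projection_state[OF P x, of f] M_ideal_projectionD(6)[OF P, of f]
    by (auto simp: state_set_def)
  show ?thesis
  proof (rule convexI)
    fix f g and u v :: real
    assume f: "f \<in> state_set x - annihilator J" and g: "g \<in> state_set x - annihilator J"
      and uv: "0 \<le> u" "0 \<le> v" "u + v = 1"
    have fg: "f \<in> cdual" "g \<in> cdual"
      using f g by (auto simp: state_set_def)
    have "P (u *\<^sub>R f + v *\<^sub>R g) = u *\<^sub>R P f + v *\<^sub>R P g"
      using M_ideal_projectionD(2,3)[OF P] fg cdual_scaleR by metis
    then have "Re (blinfun_apply (P (u *\<^sub>R f + v *\<^sub>R g)) x)
        = u * Re (blinfun_apply (P f) x) + v * Re (blinfun_apply (P g) x)"
      by (simp add: plus_blinfun.rep_eq scaleR_blinfun.rep_eq)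
    moreover have "0 < u * Re (blinfun_apply (P f) x) + v * Re (blinfun_apply (P g) x)"
    \<comment> \<open>Strict positivity needs one strictly positive weight: \<open>v = 1\<close> if
      \<open>u = 0\<close>, and \<open>u\<close> otherwise.\<close>
    proof (cases "u = 0")
      case True
      with g[unfolded mem] uv show ?thesis by simp
    next
      case False
      with f[unfolded mem] g[unfolded mem] uv show ?thesis
        by (intro add_pos_nonneg mult_pos_pos mult_nonneg_nonneg) auto
    qed
    ultimately show "u *\<^sub>R f + v *\<^sub>R g \<in> state_set x - annihilator J"
      using convexD[OF convex_state_set[OF x] _ _ uv] f g unfolding mem by simp
  qed
qed

text \<open>The target topology tests only points of \<open>J\<close>, where \<open>P f\<close> and
  \<open>f\<close> agree, so each test is a weak-star continuous evaluation.\<close>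

lemma continuous_map_projection:
  assumes P: "M_ideal_projection J P"
  shows "continuous_map (weak_star_topology cdual UNIV) (weak_star_topology (ideal_dual P) J) P"
proof (rule continuous_map_weak_star)
  show "P \<in> topspace (weak_star_topology cdual UNIV) \<rightarrow> ideal_dual P"
    by (auto simp: ideal_dual_def)
  fix j assume j: "j \<in> J"
  show "continuous_map (weak_star_topology cdual UNIV) euclidean (\<lambda>f. blinfun_apply (P f) j)"
    using M_ideal_projection_agrees[OF P _ j]
    by (intro continuous_map_eq[OF continuous_map_weak_star_apply[of j UNIV]]) auto
qed

theorem theorem7:
  fixes x :: "'a::complex_banach"
    and J :: "'a set"
    and P :: "('a \<Rightarrow>\<^sub>L complex) \<Rightarrow> ('a \<Rightarrow>\<^sub>L complex)"
  assumes "M_ideal J"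
    and "M_ideal_projection J P"
    and "norm x = 1"
    and "state_set x =
           weak_star_topology cdual UNIV closure_of
             (convex hull {f \<in> extreme_points (unit_ball_of (ideal_dual P)). blinfun_apply f x = 1})"
    and "0 \<notin> weak_star_topology (ideal_dual P) J closure_of
               extreme_points (unit_ball_of (ideal_dual P))
         \<or> weak_star_topology cdual UNIV closure_of
               extreme_points (unit_ball_of (ideal_dual P))
             \<subseteq> unit_interval_multiples (extreme_points (unit_ball_of (ideal_dual P)))"
  shows "infdist x J < 1"
proof (rule ccontr)
  assume far: "\<not> infdist x J < 1"
  note P = assms(2) and x = assms(3)
  let ?W = "weak_star_topology cdual UNIV :: ('a \<Rightarrow>\<^sub>L complex) topology"
  let ?U = "state_set x - annihilator J"
  define E where "E = extreme_points (unit_ball_of (ideal_dual P))"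
  define K where "K = {f \<in> E. blinfun_apply f x = 1}"
  have J: "csubspace J" using assms(1) by (simp add: M_ideal_def)
  then have "0 \<in> J" by (simp add: csubspace_def)
  \<comment> \<open>Since \<open>0 \<in> J\<close>, the distance is at most \<open>norm x\<close>;
    the negated goal gives the other inequality.\<close>
  then have "infdist x J = 1"
    using infdist_le[of 0 J x] x far by simp
  then obtain f0 where f0: "f0 \<in> state_set x" "f0 \<in> annihilator J"
    using infdist_attaining_annihilator[OF J x] by blast
  have hull: "state_set x = ?W closure_of (convex hull K)"
    unfolding K_def E_def by (rule assms(4))
  have E_dual: "E \<subseteq> ideal_dual P"
    by (auto simp: E_def extreme_points_def extreme_point_of_def unit_ball_of_def)
  have K: "K \<subseteq> ideal_dual P" "K \<subseteq> cdual"
    using E_dual ideal_dual_subset[OF P] by (auto simp: K_def)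
  have W_convex: "convex hull K \<subseteq> topspace ?W"
    using K(2) by (intro hull_minimal convexI) (auto simp: cdual_add cdual_scaleR)
  have K_states: "K \<subseteq> state_set x"
    using hull closure_of_subset[OF W_convex] hull_subset[of K convex] by blast
  have compact: "compactin ?W (state_set x)"
    by (rule compactin_state_set[OF x])
  have closed: "closedin ?W C" if "compactin ?W C" for C
    by (rule compactin_imp_closedin[OF Hausdorff_weak_star that])
  have clK: "?W closure_of K \<subseteq> state_set x"
    by (rule closure_of_minimal[OF K_states closed[OF compact]])
  \<comment> \<open>This is where the two alternative hypotheses enter: a limit \<open>g\<close> of
    \<open>K\<close> that annihilates \<open>J\<close> would have \<open>P g = 0\<close> and yet
    take the value 1 at \<open>x\<close>.\<close>
  have disjoint: "g \<notin> annihilator J" if g: "g \<in> ?W closure_of K" for g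
  proof
    assume "g \<in> annihilator J"
    then have Pg: "P g = 0" using M_ideal_projectionD(6)[OF P] by simp
    have gx: "blinfun_apply g x = 1" using g clK x by (auto simp: state_set_def)
    from assms(5) show False
      unfolding E_def[symmetric]
    proof
      \<comment> \<open>\<open>P\<close> fixes \<open>K\<close> and is continuous into the weak-star
        topology of the dual of \<open>J\<close>, so \<open>0 = P g\<close> would be a limit of
        extreme points there.\<close>
      assume *: "0 \<notin> weak_star_topology (ideal_dual P) J closure_of E"
      have "P ` K = K"
        using projection_ideal_dual[OF P] K(1) by force
      then have "P ` (?W closure_of K) \<subseteq> weak_star_topology (ideal_dual P) J closure_of K"
        using continuous_map_image_closure_subset[OF continuous_map_projection[OF P], of K] by simp
      also have "\<dots> \<subseteq> weak_star_topology (ideal_dual P) J closure_of E"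
        by (rule closure_of_mono) (auto simp: K_def)
      finally show False
        using * g Pg by force
    next
      \<comment> \<open>Here \<open>g\<close> is a multiple of a functional fixed by
        \<open>P\<close>, so \<open>g = P g = 0\<close>, contradicting its value at
        \<open>x\<close>.\<close>
      assume *: "?W closure_of E \<subseteq> unit_interval_multiples E"
      have "?W closure_of K \<subseteq> ?W closure_of E"
        by (rule closure_of_mono) (auto simp: K_def)
      then obtain t s where ts: "g = t *\<^sub>R s" "s \<in> E"
        using g * unfolding unit_interval_multiples_def by blast
      then have "P g = t *\<^sub>R P s" "P s = s"
        using M_ideal_projectionD(3)[OF P] ideal_dual_subset[OF P] E_dual projection_ideal_dual[OF P] by blast+
      then have "g = 0" using Pg ts(1) by simp
      with gx show False by simp
    qed
  qed
  \<comment> \<open>The open half-spaces \<open>O' j\<close> provide the cover from which a finite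
    subcover is drawn; the closed slices \<open>C j\<close> contain their states and are compact and
    convex.\<close>
  define C where "C = (\<lambda>j. {f \<in> state_set x. 1 \<le> Re (blinfun_apply f j)})"
  define O' where "O' = (\<lambda>j::'a. {f \<in> cdual. 1 < Re (blinfun_apply f j)})"
  have Re_cont: "continuous_map ?W euclidean (\<lambda>f. Re (blinfun_apply f j))" for j
    using continuous_map_compose[OF continuous_map_weak_star_apply[of j UNIV cdual], of euclidean Re]
    by (simp add: o_def continuous_on_Re)
  have C: "compactin ?W (C j)" "convex (C j)" for j
  proof -
    have "closedin ?W {f \<in> topspace ?W. Re (blinfun_apply f j) \<in> {1..}}"
      by (rule closedin_continuous_map_preimage[OF Re_cont]) simp
    from compact_Int_closedin[OF compact this] have "compactin ?W (state_set x \<inter> {f \<in> cdual. 1 \<le> Re (blinfun_apply f j)})"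
      by simp
    also have "state_set x \<inter> {f \<in> cdual. 1 \<le> Re (blinfun_apply f j)} = C j"
      by (auto simp: C_def state_set_def)
    finally show "compactin ?W (C j)" .
    have "convex {f. 1 \<le> Re (blinfun_apply f j)}"
    proof (rule convexI)
      fix f g :: "'a \<Rightarrow>\<^sub>L complex" and u v :: real
      assume "f \<in> {f. 1 \<le> Re (blinfun_apply f j)}" "g \<in> {f. 1 \<le> Re (blinfun_apply f j)}"
        and uv: "0 \<le> u" "0 \<le> v" "u + v = 1"
      then have "u * 1 + v * 1 \<le> u * Re (blinfun_apply f j) + v * Re (blinfun_apply g j)"
        by (intro add_mono mult_left_mono) auto
      with uv show "u *\<^sub>R f + v *\<^sub>R g \<in> {f. 1 \<le> Re (blinfun_apply f j)}"
        by (simp add: plus_blinfun.rep_eq scaleR_blinfun.rep_eq)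
    qed
    then have "convex (state_set x \<inter> {f. 1 \<le> Re (blinfun_apply f j)})"
      by (intro convex_Int convex_state_set[OF x])
    then show "convex (C j)"
      by (simp add: C_def Int_def)
  qed
  have C_U: "C j \<subseteq> ?U" if "j \<in> J" for j
    using that by (auto simp: C_def annihilator_def)
  have openO: "openin ?W (O' j)" for j
    using openin_continuous_map_preimage[OF Re_cont[of j], of "{1<..}"] by (simp add: O'_def)
  have "?W closure_of K \<subseteq> \<Union> (O' ` J)"
  proof
    fix g assume g: "g \<in> ?W closure_of K"
    then have gc: "g \<in> cdual" using clK by (auto simp: state_set_def)
    then obtain j where j: "j \<in> J" "blinfun_apply g j \<noteq> 0"
      using disjoint[OF g] by (auto simp: annihilator_def)
    \<comment> \<open>Rescaling \<open>j\<close> by a complex factor keeps it in \<open>J\<close>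
      and gives \<open>g\<close> the value 2, beyond the threshold 1.\<close>
    have "g \<in> O' ((2 / blinfun_apply g j) *\<^sub>C j)"
      using gc j(2) by (simp add: O'_def cdual_def)
    then show "g \<in> \<Union> (O' ` J)"
      using J j(1) by (auto simp: csubspace_def)
  qed
  moreover have "compactin ?W (?W closure_of K)"
    using closed_compactin[OF compact clK] by simp
  ultimately obtain \<F> where "finite \<F>" "\<F> \<subseteq> O' ` J" "?W closure_of K \<subseteq> \<Union>\<F>"
    using openO unfolding compactin_def by (metis (no_types, lifting) imageE)
  then obtain T where T: "finite T" "T \<subseteq> J" "?W closure_of K \<subseteq> \<Union> (O' ` T)"
    by (metis finite_subset_image)
  obtain D where D: "compactin ?W D" "convex D" "D \<subseteq> ?U" "\<Union> (C ` T) \<subseteq> D"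
    using compact_convex_cover[of "C ` T" ?U] convex_state_set_minus_annihilator[OF P x] C C_U T(1,2)
    by (metis (no_types, lifting) finite_imageI imageE subsetD)
  have "K \<subseteq> D"
  proof
    fix g assume g: "g \<in> K"
    then have "g \<in> ?W closure_of K"
      using closure_of_subset[of K ?W] K(2) by auto
    then obtain j where "j \<in> T" "g \<in> O' j" using T(3) by blast
    then have "g \<in> C j" using g K_states by (auto simp: C_def O'_def)
    with \<open>j \<in> T\<close> D(4) show "g \<in> D" by blast
  qed
  then have "convex hull K \<subseteq> D"
    by (intro hull_minimal D(2))
  \<comment> \<open>\<open>D\<close> is compact in a Hausdorff topology, hence closed, so it absorbs
    the closure of the hull, which is the whole state set. The state \<open>f0\<close> annihilating
    \<open>J\<close> would then lie in \<open>D\<close>, which avoids the annihilator.\<close>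
  then have "state_set x \<subseteq> D"
    unfolding hull by (rule closure_of_minimal[OF _ closed[OF D(1)]])
  with D(3) f0 show False by blast
qed

end
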